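(* Let $f$ satisfy Condition 1 with support in $[0,t_0)$ and let $F(z) = \int_0^{t_0} e^{-zt}f(t)\,dt$. Let $B, C$ be constants with $B > \max(C, t_0) \ge 0$ and $C \ge 0$. Let $d_0 \ge 0$, $C'$, an integer $J \ge 1$ and reals $e_1 \ge e_2 \ge \dots \ge e_J$ be given. Consider real variables $d_1, \dots, d_J$ with $d_0 \ge d_1 \ge \dots \ge d_J \ge 0$, subject to $d_j \le e_j$ ($1 \le j \le J$) and \[ D^*(d_0) = \sum_{j \le J}\bigl(F(d_0 - d_j) - F(d_0)\bigr) \le C', \] and the problem of maximizing $S^* = \sum_{j \le J}\bigl(e^{Bd_j} - e^{Cd_j}\bigr)$. Suppose $1 \le r \le J$ is an index with \[ \sum_{j=1}^{r-1}\bigl(F(d_0 - e_j) - F(d_0)\bigr) \le C' < \sum_{j=1}^{r}\bigl(F(d_0 - e_j) - F(d_0)\bigr). \] Then the optimal (maximizing) choice is $d_j = e_j$ for $j = 1, \dots, r-1$, $d_r$ equal to the unique value with \[ F(d_0 - d_r) = F(d_0) + C' - \sum_{j=1}^{r-1}\bigl(F(d_0 - e_j) - F(d_0)\bigr), \] and $d_\nu = 0$ for $r < \nu \le J$.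
   Context: Condition 1: $f:[0,\infty)\to\mathbb R$ is non-negative and continuous, supported in $[0,t_0)$, twice differentiable on $(0,t_0)$ with $f''$ continuous and bounded, and its Laplace transform $F(z) = \int_0^{t_0} e^{-zt} f(t)\,dt$ satisfies $\mathrm{Re}\,F(z) \ge 0$ for $\mathrm{Re}\,z \ge 0$.
   Formalization: The optimality claim is stated under the extra conditions e_J ≥ 0 and (described d_1) ≤ d_0, without which the described tuple is not feasible and the claim fails; existence and uniqueness of d_r are stated without these conditions. *)

theory Defs
  imports "HOL-Analysis.Analysis"
begin

text \<open>The finite Laplace transform is polymorphic so that one definition serves both the complex
  half-plane condition and the real optimisation problem; the two instances agree on the real line
  by \<open>laplace_of_real\<close> below.\<close>

definition laplace :: "(real \<Rightarrow> real) \<Rightarrow> real \<Rightarrow> 'a \<Rightarrow> 'a::{real_normed_field, banach}" where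
  "laplace f t0 z = integral {0..t0} (\<lambda>t. exp (- z * of_real t) * of_real (f t))"

text \<open>``Supported in \<open>[0, t0)\<close>'' means that \<open>f\<close> vanishes on \<open>[t0, \<infinity>)\<close>; the closed support may
  contain \<open>t0\<close>. Values of \<open>f\<close> on the negative axis are irrelevant.\<close>

definition condition1 :: "(real \<Rightarrow> real) \<Rightarrow> real \<Rightarrow> bool" where
  "condition1 f t0 \<longleftrightarrow>
     (\<forall>t\<ge>0. 0 \<le> f t) \<and>
     continuous_on {0..} f \<and>
     (\<forall>t\<ge>0. t0 \<le> t \<longrightarrow> f t = 0) \<and>
     (\<exists>f' f''.
        (\<forall>t\<in>{0<..<t0}. (f has_real_derivative f' t) (at t) \<and> (f' has_real_derivative f'' t) (at t)) \<and>
        continuous_on {0<..<t0} f'' \<and> bounded (f'' ` {0<..<t0})) \<and>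
     (\<forall>z::complex. 0 \<le> Re z \<longrightarrow> 0 \<le> Re (laplace f t0 z))"

definition D_star :: "(real \<Rightarrow> real) \<Rightarrow> nat \<Rightarrow> (nat \<Rightarrow> real) \<Rightarrow> real \<Rightarrow> real" where
  "D_star F J d d0 = (\<Sum>j=1..J. F (d0 - d j) - F d0)"

definition S_star :: "real \<Rightarrow> real \<Rightarrow> nat \<Rightarrow> (nat \<Rightarrow> real) \<Rightarrow> real" where
  "S_star B C J d = (\<Sum>j=1..J. exp (B * d j) - exp (C * d j))"

text \<open>Tuples \<open>(d_1, ..., d_J)\<close> are functions on \<open>nat\<close> of which only the values on \<open>{1..J}\<close> matter;
  the given number \<open>d_0\<close> is the separate parameter \<open>d0\<close>.\<close>

definition feasible ::
  "(real \<Rightarrow> real) \<Rightarrow> real \<Rightarrow> real \<Rightarrow> nat \<Rightarrow> (nat \<Rightarrow> real) \<Rightarrow> (nat \<Rightarrow> real) \<Rightarrow> bool" where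
  "feasible F d0 C' J e d \<longleftrightarrow>
     d 1 \<le> d0 \<and> antimono_on {1..J} d \<and> 0 \<le> d J \<and>
     (\<forall>j\<in>{1..J}. d j \<le> e j) \<and>
     D_star F J d d0 \<le> C'"

definition greedy :: "(nat \<Rightarrow> real) \<Rightarrow> nat \<Rightarrow> real \<Rightarrow> nat \<Rightarrow> real" where
  "greedy e r x j = (if j < r then e j else if j = r then x else 0)"

lemma laplace_of_real:
  assumes "condition1 f t0"
  shows "laplace f t0 (complex_of_real x) = complex_of_real (laplace f t0 x)"
proof -
  have "continuous_on {0..t0} f"
    using assms unfolding condition1_def by (auto intro: continuous_on_subset)
  then have "(\<lambda>t. exp (- x * t) * f t) integrable_on {0..t0}"
    by (intro integrable_continuous_real continuous_intros)
  then have "((\<lambda>t. exp (- x * t) * f t) has_integral laplace f t0 x) {0..t0}"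
    unfolding laplace_def by (simp add: has_integral_integral)
  then have "((\<lambda>t. complex_of_real (exp (- x * t) * f t)) has_integral
      complex_of_real (laplace f t0 x)) {0..t0}"
    by (rule has_integral_of_real)
  then show ?thesis
    unfolding laplace_def[of f t0 "complex_of_real x"]
    by (intro integral_unique) (simp add: exp_of_real[symmetric])
qed

end

theory Submission
  imports Defs
begin

text \<open>
  Put \<open>G u = F (d0 - u) - F d0\<close> and \<open>h u = exp (B u) - exp (C u)\<close>. Since \<open>f\<close> is non-negative and
  lives on \<open>[0, t0]\<close>, \<open>exp (- t0 u) G' u\<close> is non-increasing, whereas \<open>exp (- t0 u) h' u\<close> is
  strictly increasing because \<open>B > max C t0\<close>. So \<open>h' / G'\<close> is strictly increasing, i.e. \<open>h\<close> is a
  strictly convex function of \<open>G\<close>. The values \<open>G (d j)\<close> of a feasible tuple are dominated in all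
  partial sums by those of the greedy tuple, and Karamata's argument (tangent inequality plus
  summation by parts) gives strict optimality of the latter.
\<close>

section \<open>Karamata's inequality relative to \<open>G\<close>\<close>

text \<open>Subtracting the tangent leaves \<open>h - l * G\<close>, whose derivative
  \<open>G' * (h' / G' - l)\<close> is negative to the left of \<open>u\<close> and positive to the
  right within \<open>[a, \<infinity>)\<close>, so \<open>u\<close> is its strict minimum
  there.\<close>

lemma tangent_less_of_strict_mono_deriv_ratio:
  fixes h G h' G' :: "real \<Rightarrow> real"
  assumes h: "\<And>x. (h has_real_derivative h' x) (at x)"
    and G: "\<And>x. (G has_real_derivative G' x) (at x)"
    and pos: "\<And>x. 0 < G' x"
    and ratio: "\<And>x y. a \<le> x \<Longrightarrow> x < y \<Longrightarrow> h' x / G' x < h' y / G' y"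
    and uv: "a \<le> u" "a \<le> v" "u \<noteq> v"
  shows "h' u / G' u * (G v - G u) < h v - h u"
proof -
  define l where "l = h' u / G' u"
  define \<psi> where "\<psi> x = h x - l * G x" for x
  have \<psi>: "(\<psi> has_real_derivative h' x - l * G' x) (at x)" for x
    unfolding \<psi>_def by (auto intro!: derivative_eq_intros h G)
  then have cont: "continuous_on S \<psi>" for S
    by (meson DERIV_isCont continuous_at_imp_continuous_on)
  have "\<psi> u < \<psi> v"
  proof (cases "u < v")
    case True
    \<comment> \<open>The derivative of \<open>\<psi>\<close> vanishes at \<open>u\<close>, so its
      sign is used on the open interval only.\<close>
    show ?thesis
    proof (rule DERIV_pos_imp_increasing_open[OF True _ cont])
      fix x assume "u < x" "x < v"
      then have "l < h' x / G' x" unfolding l_def using ratio uv by simp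
      then have "0 < h' x - l * G' x" using pos[of x] by (simp add: field_simps)
      then show "\<exists>y. (\<psi> has_real_derivative y) (at x) \<and> 0 < y" using \<psi> by blast
    qed
  next
    case False
    then have "v < u" using uv by simp
    then show ?thesis
    proof (rule DERIV_neg_imp_decreasing_open[OF _ _ cont])
      fix x assume "v < x" "x < u"
      then have "h' x / G' x < l" unfolding l_def using ratio uv by simp
      then have "h' x - l * G' x < 0" using pos[of x] by (simp add: field_simps)
      then show "\<exists>y. (\<psi> has_real_derivative y) (at x) \<and> y < 0" using \<psi> by blast
    qed
  qed
  then have "l * (G v - G u) < h v - h u" by (simp add: \<psi>_def algebra_simps)
  then show ?thesis by (simp add: l_def)
qed

text \<open>Summation by parts as an induction: lowering the weight of a non-negative partial sum
  from \<open>c n\<close> to \<open>c (Suc n)\<close> can only decrease the product.\<close>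

lemma sum_antimono_weights_ge:
  fixes c b :: "nat \<Rightarrow> real"
  assumes "antimono_on {1..n} c" and "\<And>k. k \<le> n \<Longrightarrow> 0 \<le> (\<Sum>j=1..k. b j)"
  shows "c n * (\<Sum>j=1..n. b j) \<le> (\<Sum>j=1..n. c j * b j)"
  using assms
proof (induction n)
  case (Suc n)
  \<comment> \<open>For \<open>n = 0\<close> the sum is empty; the order on
    \<open>{1..Suc n}\<close> says nothing about \<open>c 0\<close>.\<close>
  have "c (Suc n) * (\<Sum>j=1..n. b j) \<le> c n * (\<Sum>j=1..n. b j)"
  proof (cases "n = 0")
    case False
    then have "c (Suc n) \<le> c n" using Suc.prems(1) by (auto simp: monotone_on_def)
    then show ?thesis using Suc.prems(2)[of n] by (simp add: mult_right_mono)
  qed simp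
  also have "\<dots> \<le> (\<Sum>j=1..n. c j * b j)"
    using Suc.prems by (intro Suc.IH) (auto simp: monotone_on_def)
  finally show ?case by (simp add: algebra_simps)
qed simp

text \<open>Tangents are taken at the points \<open>d j\<close>, so the order of \<open>d\<close>
  sorts the slopes. The total of \<open>G (a j)\<close> may exceed that of \<open>G (d j)\<close>;
  the surplus does no harm because the slopes are non-negative. One index with
  \<open>d j \<noteq> a j\<close> makes the result strict.\<close>

lemma karamata_strict:
  fixes h G h' G' :: "real \<Rightarrow> real" and a d :: "nat \<Rightarrow> real"
  assumes h: "\<And>x. (h has_real_derivative h' x) (at x)"
    and G: "\<And>x. (G has_real_derivative G' x) (at x)"
    and pos: "\<And>x. 0 < G' x"
    and ratio: "\<And>x y. 0 \<le> x \<Longrightarrow> x < y \<Longrightarrow> h' x / G' x < h' y / G' y"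
    and h'_nonneg: "\<And>x. 0 \<le> x \<Longrightarrow> 0 \<le> h' x"
    and d: "antimono_on {1..n} d" "\<And>j. j \<in> {1..n} \<Longrightarrow> 0 \<le> d j"
    and a: "\<And>j. j \<in> {1..n} \<Longrightarrow> 0 \<le> a j"
    and partial: "\<And>k. k \<le> n \<Longrightarrow> (\<Sum>j=1..k. G (d j)) \<le> (\<Sum>j=1..k. G (a j))"
    and neq: "\<exists>j\<in>{1..n}. d j \<noteq> a j"
  shows "(\<Sum>j=1..n. h (d j)) < (\<Sum>j=1..n. h (a j))"
proof -
  define c where "c j = h' (d j) / G' (d j)" for j
  define b where "b j = G (a j) - G (d j)" for j
  have c: "antimono_on {1..n} c"
  proof (rule monotone_onI)
    fix i j assume ij: "i \<in> {1..n}" "j \<in> {1..n}" "i \<le> j"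
    then have "d j \<le> d i" using d(1) by (auto simp: monotone_on_def)
    then show "c j \<le> c i" using ratio[of "d j" "d i"] d(2)[of j] ij
      by (cases "d j = d i") (auto simp: c_def)
  qed
  have b: "0 \<le> (\<Sum>j=1..k. b j)" if "k \<le> n" for k
    using partial[OF that] by (simp add: b_def sum_subtractf)
  have "1 \<le> n" using neq by auto
  then have "0 \<le> c n"
    using h'_nonneg[of "d n"] d(2)[of n] pos[of "d n"] by (simp add: c_def)
  then have "0 \<le> c n * (\<Sum>j=1..n. b j)" using b by simp
  also have "\<dots> \<le> (\<Sum>j=1..n. c j * b j)" using sum_antimono_weights_ge[OF c b] by blast
  also have "\<dots> < (\<Sum>j=1..n. h (a j) - h (d j))"
  proof (rule sum_strict_mono_ex1)
    have strict: "c j * b j < h (a j) - h (d j)" if "j \<in> {1..n}" "d j \<noteq> a j" for j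
      unfolding c_def b_def
      using tangent_less_of_strict_mono_deriv_ratio[of h h' G G' 0, OF h G pos ratio d(2) a] that
      by blast
    then show "\<exists>j\<in>{1..n}. c j * b j < h (a j) - h (d j)" using neq by blast
    show "\<forall>j\<in>{1..n}. c j * b j \<le> h (a j) - h (d j)"
    proof
      fix j assume "j \<in> {1..n}"
      then show "c j * b j \<le> h (a j) - h (d j)"
        using strict[of j] by (cases "d j = a j") (auto simp: b_def)
    qed
  qed simp
  finally show ?thesis by (simp add: sum_subtractf)
qed

section \<open>Growth of the exponential terms and of the moments of \<open>f\<close>\<close>

lemma mult_exp_less:
  fixes B C u :: real
  assumes "C < B" "0 \<le> C" "0 \<le> u"
  shows "C * exp (C * u) < B * exp (B * u)"
proof -
  have "C * exp (C * u) \<le> C * exp (B * u)"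
    using assms by (intro mult_left_mono) (auto intro: mult_right_mono)
  also have "\<dots> < B * exp (B * u)" using assms by simp
  finally show ?thesis .
qed

text \<open>The right side minus the left is
  \<open>B * exp (B * u) * ?X - C * exp (C * u) * ?Y\<close>. Both the coefficient and the gap above
  rate \<open>s\<close> are larger for \<open>B\<close> than for \<open>C\<close>; since
  \<open>?Y\<close> may be negative, the gaps are compared first.\<close>

lemma exp_diff_deriv_growth:
  fixes B C s u v :: real
  assumes "C < B" "s < B" "0 \<le> C" "0 \<le> u" "u < v"
  shows "exp (s * (v - u)) * (B * exp (B * u) - C * exp (C * u)) < B * exp (B * v) - C * exp (C * v)"
proof -
  let ?X = "exp (B * (v - u)) - exp (s * (v - u))" and ?Y = "exp (C * (v - u)) - exp (s * (v - u))"
  have less: "C * exp (C * u) < B * exp (B * u)" using assms by (intro mult_exp_less)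
  have "0 < ?X" "?Y \<le> ?X" using assms by (auto intro: mult_right_mono)
  then have "C * exp (C * u) * ?Y \<le> C * exp (C * u) * ?X"
    using assms by (intro mult_left_mono) auto
  also have "\<dots> < B * exp (B * u) * ?X" using less \<open>0 < ?X\<close> by (rule mult_strict_right_mono)
  finally have *: "C * exp (C * u) * ?Y < B * exp (B * u) * ?X" .
  have "exp (B * v) = exp (B * u) * exp (B * (v - u))" "exp (C * v) = exp (C * u) * exp (C * (v - u))"
    by (simp_all add: exp_add[symmetric] algebra_simps)
  with * show ?thesis by (simp add: algebra_simps)
qed

lemma laplace_has_real_derivative:
  fixes f :: "real \<Rightarrow> real"
  assumes "continuous_on {0..t0} f"
  shows "(laplace f t0 has_real_derivative - laplace (\<lambda>t. t * f t) t0 y) (at y)"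
proof -
  have "((\<lambda>x. integral (cbox 0 t0) (\<lambda>t. exp (- x * t) * f t)) has_real_derivative
      integral (cbox 0 t0) (\<lambda>t. - (exp (- y * t) * (t * f t)))) (at y within UNIV)"
  proof (rule leibniz_rule_field_derivative)
    show "((\<lambda>x. exp (- x * t) * f t) has_real_derivative - (exp (- x * t) * (t * f t))) (at x within UNIV)"
      for x t by (auto intro!: derivative_eq_intros)
    show "(\<lambda>t. exp (- x * t) * f t) integrable_on cbox 0 t0" for x
      using assms by (auto intro!: integrable_continuous_real continuous_intros)
    show "continuous_on (UNIV \<times> cbox 0 t0) (\<lambda>(x, t). - (exp (- x * t) * (t * f t)))"
      unfolding case_prod_beta
      by (intro continuous_intros continuous_on_compose2[OF assms]) auto
  qed auto
  then show ?thesis by (simp add: laplace_def[abs_def])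
qed

text \<open>Two different values of the transform exclude a zero integral: a continuous non-negative
  integrand would then vanish identically.\<close>

lemma laplace_moment_pos:
  fixes f :: "real \<Rightarrow> real"
  assumes cont: "continuous_on {0..t0} f"
    and nonneg: "\<And>t. 0 \<le> t \<Longrightarrow> 0 \<le> f t"
    and nonconst: "laplace f t0 y \<noteq> (laplace f t0 z :: real)"
  shows "0 < (laplace (\<lambda>t. t * f t) t0 w :: real)"
proof -
  let ?g = "\<lambda>t. exp (- w * t) * (t * f t)"
  have g: "continuous_on {0..t0} ?g" using cont by (intro continuous_intros)
  have t0: "0 < t0"
  proof (rule ccontr)
    assume "\<not> 0 < t0"
    \<comment> \<open>The integral over an empty or one-point interval is 0, which would make the
      transform constant.\<close>
    then have "t0 < 0 \<or> t0 = 0" by auto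
    then show False using nonconst by (auto simp: laplace_def)
  qed
  have "integral {0..t0} ?g \<noteq> 0"
  proof
    assume "integral {0..t0} ?g = 0"
    then have "\<forall>t\<in>{0..t0}. ?g t = 0"
      using integral_eq_0_iff[OF g t0] nonneg by auto
    \<comment> \<open>At \<open>t = 0\<close> the factor \<open>t\<close> hides the value of
      \<open>f\<close>, but there both exponentials equal 1.\<close>
    then have "exp (- y * t) * f t = exp (- z * t) * f t" if "t \<in> {0..t0}" for t
      using that by auto
    then have "integral {0..t0} (\<lambda>t. exp (- y * t) * f t) = integral {0..t0} (\<lambda>t. exp (- z * t) * f t)"
      by (intro integral_cong)
    then show False using nonconst by (simp add: laplace_def)
  qed
  moreover have "0 \<le> integral {0..t0} ?g"
    using g nonneg by (intro integral_nonneg integrable_continuous_real) auto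
  ultimately show ?thesis by (simp add: laplace_def)
qed

text \<open>Lowering the argument from \<open>y\<close> to \<open>w\<close> multiplies the kernel at
  \<open>t\<close> by \<open>exp ((y - w) * t)\<close>, and \<open>t \<le> t0\<close>.\<close>

lemma laplace_moment_growth:
  fixes f :: "real \<Rightarrow> real"
  assumes cont: "continuous_on {0..t0} f"
    and nonneg: "\<And>t. 0 \<le> t \<Longrightarrow> 0 \<le> f t"
    and "w \<le> y"
  shows "laplace (\<lambda>t. t * f t) t0 w \<le> exp (t0 * (y - w)) * laplace (\<lambda>t. t * f t) t0 y"
proof -
  have "integral {0..t0} (\<lambda>t. exp (- w * t) * (t * f t))
      \<le> integral {0..t0} (\<lambda>t. exp (t0 * (y - w)) * (exp (- y * t) * (t * f t)))"
  proof (rule integral_le)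
    fix t assume t: "t \<in> {0..t0}"
    then have "t * (y - w) \<le> t0 * (y - w)" using assms(3) by (intro mult_right_mono) auto
    then have "exp (- w * t) \<le> exp (t0 * (y - w)) * exp (- y * t)"
      by (simp add: exp_add[symmetric] algebra_simps)
    then have "exp (- w * t) * (t * f t) \<le> exp (t0 * (y - w)) * exp (- y * t) * (t * f t)"
      using t nonneg by (intro mult_right_mono) auto
    then show "exp (- w * t) * (t * f t) \<le> exp (t0 * (y - w)) * (exp (- y * t) * (t * f t))"
      by (simp add: mult.assoc)
  qed (use cont in \<open>auto intro!: integrable_continuous_real continuous_intros\<close>)
  then show ?thesis by (simp add: laplace_def)
qed

section \<open>Optimality of the greedy tuple\<close>

text \<open>The premises \<open>0 \<le> e J\<close> and \<open>greedy e r x 1 \<le> d0\<close> make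
  the greedy tuple feasible; otherwise it would break \<open>d J \<le> e J\<close> or
  \<open>d 1 \<le> d0\<close>. The equivalence also gives uniqueness of the maximizer on
  \<open>{1..J}\<close>.\<close>

theorem theoremK:
  fixes f :: "real \<Rightarrow> real" and F :: "real \<Rightarrow> real" and t0 B C C' d0 :: real
    and J r :: nat and e :: "nat \<Rightarrow> real"
  assumes cond: "condition1 f t0"
    and F_eq: "F = laplace f t0"
    and B: "B > max C t0" "max C t0 \<ge> 0"
    and C: "C \<ge> 0"
    and d0: "d0 \<ge> 0"
    and J: "J \<ge> 1"
    and e: "antimono_on {1..J} e"
    and r: "1 \<le> r" "r \<le> J"
    and r_low: "(\<Sum>j=1..<r. F (d0 - e j) - F d0) \<le> C'"
    and r_up: "C' < (\<Sum>j=1..r. F (d0 - e j) - F d0)"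
  shows "(\<exists>!x. F (d0 - x) = F d0 + C' - (\<Sum>j=1..<r. F (d0 - e j) - F d0)) \<and>
    (\<forall>x. F (d0 - x) = F d0 + C' - (\<Sum>j=1..<r. F (d0 - e j) - F d0) \<longrightarrow>
       0 \<le> e J \<longrightarrow> greedy e r x 1 \<le> d0 \<longrightarrow>
       (\<forall>d. is_arg_max (S_star B C J) (feasible F d0 C' J e) d \<longleftrightarrow>
            (\<forall>j\<in>{1..J}. d j = greedy e r x j)))"
proof -
  have cont: "continuous_on {0..t0} f"
    using cond unfolding condition1_def by (auto intro: continuous_on_subset)
  have nonneg: "\<And>t. 0 \<le> t \<Longrightarrow> 0 \<le> f t"
    using cond unfolding condition1_def by auto
  define G where "G u = F (d0 - u) - F d0" for u
  define G' where "G' u = laplace (\<lambda>t. t * f t) t0 (d0 - u)" for u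
  define h where "h u = exp (B * u) - exp (C * u)" for u
  define h' where "h' u = B * exp (B * u) - C * exp (C * u)" for u
  \<comment> \<open>\<open>R\<close> is the budget left for entry \<open>r\<close> once the earlier
    entries sit at their caps.\<close>
  define R where "R = C' - (\<Sum>j=1..<r. G (e j))"
  have BC: "C < B" "t0 < B" using B by auto
  have "(\<Sum>j=1..r. G (e j)) = (\<Sum>j=1..<r. G (e j)) + G (e r)"
    using r(1) by (simp add: atLeastLessThanSuc_atLeastAtMost[symmetric])
  then have R: "0 \<le> R" "R < G (e r)"
    using r_low r_up by (simp_all add: R_def G_def)
  \<comment> \<open>\<open>G (e r) > 0\<close> supplies two distinct values of the
    transform.\<close>
  then have nonconst: "laplace f t0 (d0 - e r) \<noteq> laplace f t0 d0"
    by (simp add: G_def F_eq)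
  have pos: "0 < G' u" for u
    unfolding G'_def by (rule laplace_moment_pos[OF cont nonneg nonconst])
  have G: "(G has_real_derivative G' u) (at u)" for u
    unfolding G_def G'_def F_eq
    by (auto intro!: derivative_eq_intros DERIV_chain2[OF laplace_has_real_derivative[OF cont]])
  have h: "(h has_real_derivative h' u) (at u)" for u
    unfolding h_def h'_def by (auto intro!: derivative_eq_intros)
  have G_mono: "strict_mono G"
    using DERIV_pos_imp_increasing G pos by (meson strict_monoI)
  then have G_less: "G u < G v \<longleftrightarrow> u < v" and G_le: "G u \<le> G v \<longleftrightarrow> u \<le> v" for u v
    by (simp_all add: strict_mono_less strict_mono_less_eq)
  have G0: "G 0 = 0" by (simp add: G_def)
  have h'_pos: "0 < h' u" if "0 \<le> u" for u
    using mult_exp_less[OF BC(1) C that] by (simp add: h'_def)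
  have ratio: "h' u / G' u < h' v / G' v" if "0 \<le> u" "u < v" for u v
  proof -
    \<comment> \<open>The reflection \<open>d0 - u\<close> turns the larger \<open>v\<close> into
      the smaller argument.\<close>
    have "G' v \<le> exp (t0 * (v - u)) * G' u"
      using laplace_moment_growth[OF cont nonneg, of "d0 - v" "d0 - u"] that by (simp add: G'_def)
    then have "h' u * G' v \<le> h' u * (exp (t0 * (v - u)) * G' u)"
      using h'_pos[of u] that by (intro mult_left_mono) auto
    also have "\<dots> = exp (t0 * (v - u)) * h' u * G' u" by simp
    also have "\<dots> < h' v * G' u"
      unfolding h'_def using exp_diff_deriv_growth[OF BC C that] pos by (intro mult_strict_right_mono)
    finally show ?thesis using pos by (simp add: divide_simps)
  qed
  have x_eq: "F (d0 - x) = F d0 + C' - (\<Sum>j=1..<r. F (d0 - e j) - F d0) \<longleftrightarrow> G x = R" for x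
    by (auto simp: G_def R_def)
  have "0 < e r" using R G_less[of 0 "e r"] G0 by simp
  then have "\<exists>x. 0 \<le> x \<and> x \<le> e r \<and> G x = R"
    using R G0 DERIV_isCont[OF G] by (intro IVT) auto
  then have unique: "\<exists>!x. G x = R"
    using strict_mono_eq[OF G_mono] by metis
  have opt: "is_arg_max (S_star B C J) (feasible F d0 C' J e) d \<longleftrightarrow> (\<forall>j\<in>{1..J}. d j = greedy e r x j)"
    if x: "G x = R" and eJ: "0 \<le> e J" and a1: "greedy e r x 1 \<le> d0" for x d
  proof -
    let ?a = "greedy e r x"
    have x0: "0 \<le> x" and xe: "x < e r" using R x G_le[of 0 x] G_less[of x "e r"] G0 by auto
    have e_nonneg: "0 \<le> e j" if "j \<in> {1..J}" for j
      using monotone_onD[OF e that, of J] that eJ by auto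
    have e_anti: "e j \<le> e i" if "1 \<le> i" "i \<le> j" "j \<le> J" for i j
      using monotone_onD[OF e, of i j] that by auto
    have a_nonneg: "0 \<le> ?a j" if "j \<in> {1..J}" for j
      using that e_nonneg x0 by (auto simp: greedy_def)
    have a_le: "?a j \<le> e j" if "j \<in> {1..J}" for j
      using that e_nonneg xe by (auto simp: greedy_def)
    have a_anti: "antimono_on {1..J} ?a"
    proof (rule monotone_onI)
      fix i j assume ij: "i \<in> {1..J}" "j \<in> {1..J}" "i \<le> j"
      consider "j < r" | "j = r" | "r < j" by linarith
      then show "?a j \<le> ?a i"
      proof cases
        case 1
        then show ?thesis using ij e_anti by (auto simp: greedy_def)
      next
        case 2
        then show ?thesis using ij e_anti[of i r] r xe by (auto simp: greedy_def)
      next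
        case 3
        then show ?thesis using a_nonneg[OF ij(1)] by (simp add: greedy_def)
      qed
    qed
    \<comment> \<open>The budget is spent exactly at index \<open>r\<close>; later zeros cost
      \<open>G 0 = 0\<close>.\<close>
    have sum_a: "(\<Sum>j=1..k. G (?a j)) = C'" if "r \<le> k" for k
    proof -
      have "{1..k} = {1..<r} \<union> {r} \<union> {r<..k}" using r that by auto
      then have "(\<Sum>j=1..k. G (?a j)) = (\<Sum>j\<in>{1..<r} \<union> {r} \<union> {r<..k}. G (?a j))" by simp
      also have "\<dots> = (\<Sum>j=1..<r. G (?a j)) + G (?a r) + (\<Sum>j\<in>{r<..k}. G (?a j))"
        by (subst sum.union_disjoint; fastforce)+
      also have "\<dots> = (\<Sum>j=1..<r. G (e j)) + R" using x by (simp add: greedy_def G0)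
      finally show ?thesis by (simp add: R_def)
    qed
    have D: "D_star F J d d0 = (\<Sum>j=1..J. G (d j))" for d
      by (simp add: D_star_def G_def)
    have S: "S_star B C J d = (\<Sum>j=1..J. h (d j))" for d
      by (simp add: S_star_def h_def)
    have feas_a: "feasible F d0 C' J e d" if "\<forall>j\<in>{1..J}. d j = ?a j" for d
    proof -
      have "D_star F J d d0 = (\<Sum>j=1..J. G (?a j))" unfolding D using that by (intro sum.cong) auto
      then have "D_star F J d d0 \<le> C'" using sum_a[OF r(2)] by simp
      moreover have "antimono_on {1..J} d" using a_anti that by (simp add: monotone_on_def)
      ultimately show ?thesis
        using that J a1 a_le a_nonneg by (auto simp: feasible_def)
    qed
    have S_a: "S_star B C J d = S_star B C J ?a" if "\<forall>j\<in>{1..J}. d j = ?a j" for d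
      unfolding S using that by (intro sum.cong) auto
    have less: "S_star B C J d < S_star B C J ?a"
      if d: "feasible F d0 C' J e d" and neq: "\<exists>j\<in>{1..J}. d j \<noteq> ?a j" for d
    proof -
      have anti: "antimono_on {1..J} d" and "0 \<le> d J" and d_le: "\<And>j. j \<in> {1..J} \<Longrightarrow> d j \<le> e j"
        and DC: "(\<Sum>j=1..J. G (d j)) \<le> C'"
        using d by (auto simp: feasible_def D)
      have d_nonneg: "0 \<le> d j" if "j \<in> {1..J}" for j
        using monotone_onD[OF anti that, of J] that \<open>0 \<le> d J\<close> by auto
      \<comment> \<open>From \<open>r\<close> on, the greedy sum is \<open>C'\<close>, which bounds
        the full sum for \<open>d\<close> and hence, its terms being non-negative, each partial sum.
        Before \<open>r\<close>, the caps give a termwise comparison.\<close>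
      have partial: "(\<Sum>j=1..k. G (d j)) \<le> (\<Sum>j=1..k. G (?a j))" if "k \<le> J" for k
      proof (cases "r \<le> k")
        case True
        have "(\<Sum>j=1..k. G (d j)) \<le> (\<Sum>j=1..J. G (d j))"
          using that d_nonneg G_le[of 0] G0 by (intro sum_mono2) auto
        then show ?thesis using DC sum_a[OF True] by simp
      next
        case False
        then show ?thesis
          using that d_le by (intro sum_mono) (auto simp: G_le greedy_def)
      qed
      show ?thesis unfolding S
        using karamata_strict[OF h G pos ratio less_imp_le[OF h'_pos] anti d_nonneg a_nonneg partial neq]
        by blast
    qed
    show ?thesis
    proof
      assume "is_arg_max (S_star B C J) (feasible F d0 C' J e) d"
      then show "\<forall>j\<in>{1..J}. d j = ?a j"
        using less[of d] feas_a[of ?a] by (auto simp: is_arg_max_def)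
    next
      assume d: "\<forall>j\<in>{1..J}. d j = ?a j"
      \<comment> \<open>A feasible \<open>y\<close> either agrees with \<open>?a\<close> on
        \<open>{1..J}\<close> and has the same value, or is strictly worse.\<close>
      have "\<not> S_star B C J d < S_star B C J y" if "feasible F d0 C' J e y" for y
        using less[OF that] S_a[of y] S_a[OF d] by force
      then show "is_arg_max (S_star B C J) (feasible F d0 C' J e) d"
        using feas_a[OF d] by (auto simp: is_arg_max_def)
    qed
  qed
  show ?thesis unfolding x_eq using unique opt by blast
qed

end
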